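(* Let $\sigma_i=\zeta i^{-\alpha}$, $i=1,\ldots,n$, with $\zeta>0$, $\alpha>0$, let $1<k\le n-1$, let $\epsilon\ge0$ satisfy $1+2\epsilon<\frac{\sigma_k}{\sigma_{k+1}}$, and let $C_k=A_k(\theta,j)$, with $1\le j\le k-1$ and $\theta\in[0,1]$, be the best or near best rank $k$ approximation to $A$ given by $$C_k=A_k-\sigma_{k+1}U_k\,\mathrm{diag}\bigl(\theta(1+\epsilon),\ldots,\theta(1+\epsilon),\underbrace{(1+\epsilon)}_{j},\theta(1+\epsilon),\ldots,\theta(1+\epsilon)\bigr)V_k^T .$$ (i) For $0<\alpha\le1$, if $\theta$ is sufficiently close to one and $k>1$, it holds that $$\sigma_k-\theta(1+\epsilon)\sigma_{k+1}<\sigma_{k+1},$$ that is, the smallest nonzero singular value $\sigma_k-\theta(1+\epsilon)\sigma_{k+1}$ of $C_k$ does not lie between $\sigma_{k+1}$ and $\sigma_k$; if $\theta$ is sufficiently close to zero, then $\sigma_k-\theta(1+\epsilon)\sigma_{k+1}$ lies between $\sigma_{k+1}$ and $\sigma_k$: $$\sigma_{k+1}<\sigma_k-\theta(1+\epsilon)\sigma_{k+1}<\sigma_k .$$ (ii) If $\alpha>1$ sufficiently (i.e. $\alpha>1$ is sufficiently large), then $$\sigma_{k+1}<\sigma_k-\theta(1+\epsilon)\sigma_{k+1}<\sigma_k$$ holds for $k>1$ and any $\theta\in[0,1]$.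
   Context: $\|\cdot\|$ is the 2-norm (spectral norm). $A\in\mathbb{R}^{m\times n}$, $m\ge n$, has simple singular values $\sigma_1>\sigma_2>\cdots>\sigma_n>0$ and compact SVD $A=U\Sigma V^T$ with $\Sigma=\mathrm{diag}(\sigma_1,\ldots,\sigma_n)$, $U=(u_1,\ldots,u_n)$, $V=(v_1,\ldots,v_n)$. Put $U_k=(u_1,\ldots,u_k)$, $V_k=(v_1,\ldots,v_k)$, $\Sigma_k=\mathrm{diag}(\sigma_1,\ldots,\sigma_k)$, $A_k=U_k\Sigma_kV_k^T$. A rank $k$ matrix $C_k$ with $\|A-C_k\|=(1+\epsilon)\sigma_{k+1}$, $\epsilon\ge0$, is called a best rank $k$ approximation to $A$ if $\epsilon=0$, and a near best rank $k$ approximation if $(1+\epsilon)\sigma_{k+1}<\frac{\sigma_k+\sigma_{k+1}}{2}$, i.e. $1+2\epsilon<\sigma_k/\sigma_{k+1}$. In the diagonal matrix in the definition of $C_k$, the $j$-th diagonal entry is $1+\epsilon$ and all other $k-1$ entries are $\theta(1+\epsilon)$.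
   Formalization: At θ = 0 the middle term σ_k − θ(1+ε)σ_{k+1} equals σ_k, so the strict upper inequality "< σ_k" in (i) (θ near zero) and (ii) is false there; it is replaced by equality at θ = 0 and kept strict for every θ ≠ 0. *)

theory Defs
  imports "HOL-Analysis.Analysis"
begin

text \<open>
  The column vectors \<open>u\<^sub>1, \<dots>, u\<^sub>n\<close> and \<open>v\<^sub>1, \<dots>, v\<^sub>n\<close> of \<open>U\<close> and \<open>V\<close>, and the diagonal
  entries of diagonal matrices, are given by functions on the naturals, used only on \<open>1, 2, \<dots>\<close>.
  In this way the number \<open>k\<close> of columns of \<open>U\<^sub>k\<close> and \<open>V\<^sub>k\<close> can be a natural number instead of a type.
\<close>

definition spectral_norm :: "real^'n^'m \<Rightarrow> real"
  where "spectral_norm M = onorm ((*v) M)"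

definition singular_value :: "real^'n^'m \<Rightarrow> real \<Rightarrow> bool"
  where "singular_value M s \<longleftrightarrow>
    0 \<le> s \<and> (\<exists>x. x \<noteq> 0 \<and> (transpose M ** M) *v x = s\<^sup>2 *\<^sub>R x)"

definition smallest_nonzero_singular_value :: "real^'n^'m \<Rightarrow> real \<Rightarrow> bool"
  where "smallest_nonzero_singular_value M s \<longleftrightarrow>
    singular_value M s \<and> s \<noteq> 0 \<and> (\<forall>t. singular_value M t \<and> t \<noteq> 0 \<longrightarrow> s \<le> t)"

text \<open>\<open>U_D_VT k u d v\<close> is the product \<open>U\<^sub>k diag(d\<^sub>1, \<dots>, d\<^sub>k) V\<^sub>k\<^sup>T\<close>, where
  \<open>U\<^sub>k = (u\<^sub>1, \<dots>, u\<^sub>k)\<close> and \<open>V\<^sub>k = (v\<^sub>1, \<dots>, v\<^sub>k)\<close>, written out entrywise.\<close>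

definition U_D_VT ::
    "nat \<Rightarrow> (nat \<Rightarrow> real^'m) \<Rightarrow> (nat \<Rightarrow> real) \<Rightarrow> (nat \<Rightarrow> real^'n) \<Rightarrow> real^'n^'m"
  where "U_D_VT k u d v = (\<chi> r c. \<Sum>i=1..k. u i $ r * d i * v i $ c)"

definition orthonormal_columns :: "nat \<Rightarrow> (nat \<Rightarrow> 'a::real_inner) \<Rightarrow> bool"
  where "orthonormal_columns k w \<longleftrightarrow>
    (\<forall>i\<in>{1..k}. \<forall>j\<in>{1..k}. w i \<bullet> w j = (if i = j then 1 else 0))"

text \<open>Compact SVD of an \<open>m \<times> n\<close> matrix, \<open>m \<ge> n\<close>, with simple and positive singular values.\<close>

definition compact_svd ::
    "real^'n^'m \<Rightarrow> (nat \<Rightarrow> real^'m) \<Rightarrow> (nat \<Rightarrow> real) \<Rightarrow> (nat \<Rightarrow> real^'n) \<Rightarrow> bool"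
  where "compact_svd A u \<sigma> v \<longleftrightarrow>
    CARD('n) \<le> CARD('m) \<and>
    orthonormal_columns CARD('n) u \<and> orthonormal_columns CARD('n) v \<and>
    (\<forall>i\<in>{1..CARD('n)}. 0 < \<sigma> i) \<and>
    (\<forall>i\<in>{1..CARD('n)}. \<forall>j\<in>{1..CARD('n)}. i < j \<longrightarrow> \<sigma> j < \<sigma> i) \<and>
    A = U_D_VT CARD('n) u \<sigma> v"

text \<open>In the following three definitions \<open>\<sigma>\<close> lists the singular values of \<open>A\<close>.\<close>

definition rank_approx :: "real^'n^'m \<Rightarrow> (nat \<Rightarrow> real) \<Rightarrow> nat \<Rightarrow> real \<Rightarrow> real^'n^'m \<Rightarrow> bool"
  where "rank_approx A \<sigma> k \<epsilon> C \<longleftrightarrow>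
    0 \<le> \<epsilon> \<and> rank C = k \<and> spectral_norm (A - C) = (1 + \<epsilon>) * \<sigma> (k + 1)"

definition best_rank_approx :: "real^'n^'m \<Rightarrow> (nat \<Rightarrow> real) \<Rightarrow> nat \<Rightarrow> real^'n^'m \<Rightarrow> bool"
  where "best_rank_approx A \<sigma> k C \<longleftrightarrow> rank_approx A \<sigma> k 0 C"

definition near_best_rank_approx ::
    "real^'n^'m \<Rightarrow> (nat \<Rightarrow> real) \<Rightarrow> nat \<Rightarrow> real \<Rightarrow> real^'n^'m \<Rightarrow> bool"
  where "near_best_rank_approx A \<sigma> k \<epsilon> C \<longleftrightarrow>
    rank_approx A \<sigma> k \<epsilon> C \<and> (1 + \<epsilon>) * \<sigma> (k + 1) < (\<sigma> k + \<sigma> (k + 1)) / 2"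

text \<open>The matrix \<open>A\<^sub>k(\<theta>, j)\<close>.\<close>

definition A_trunc :: "nat \<Rightarrow> real \<Rightarrow> (nat \<Rightarrow> real^'m) \<Rightarrow> (nat \<Rightarrow> real) \<Rightarrow> (nat \<Rightarrow> real^'n) \<Rightarrow>
    real \<Rightarrow> nat \<Rightarrow> real^'n^'m"
  where "A_trunc k \<epsilon> u \<sigma> v \<theta> j =
    U_D_VT k u \<sigma> v
      - \<sigma> (k + 1) *\<^sub>R U_D_VT k u (\<lambda>i. if i = j then 1 + \<epsilon> else \<theta> * (1 + \<epsilon>)) v"

definition power_law :: "real \<Rightarrow> real \<Rightarrow> nat \<Rightarrow> real"
  where "power_law \<zeta> \<alpha> i = \<zeta> * real i powr (- \<alpha>)"

definition power_law_setting ::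
    "real \<Rightarrow> real \<Rightarrow> nat \<Rightarrow> real \<Rightarrow> real^'n^'m \<Rightarrow> (nat \<Rightarrow> real^'m) \<Rightarrow> (nat \<Rightarrow> real) \<Rightarrow>
      (nat \<Rightarrow> real^'n) \<Rightarrow> bool"
  where "power_law_setting \<zeta> \<alpha> k \<epsilon> A u \<sigma> v \<longleftrightarrow>
    0 < \<zeta> \<and> 0 < \<alpha> \<and> (\<forall>i\<in>{1..CARD('n)}. \<sigma> i = power_law \<zeta> \<alpha> i) \<and> compact_svd A u \<sigma> v \<and>
    1 < k \<and> k \<le> CARD('n) - 1 \<and> 0 \<le> \<epsilon> \<and> 1 + 2 * \<epsilon> < \<sigma> k / \<sigma> (k + 1)"

text \<open>\<open>\<sigma>\<^sub>k\<^sub>+\<^sub>1 < \<sigma>\<^sub>k - \<theta>(1 + \<epsilon>)\<sigma>\<^sub>k\<^sub>+\<^sub>1 < \<sigma>\<^sub>k\<close>, except that for \<open>\<theta> = 0\<close>, where the middle term equals \<open>\<sigma>\<^sub>k\<close>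
  and the upper inequality cannot be strict, it becomes that equality.\<close>

definition lies_between :: "(nat \<Rightarrow> real) \<Rightarrow> nat \<Rightarrow> real \<Rightarrow> real \<Rightarrow> bool"
  where "lies_between \<sigma> k \<epsilon> \<theta> \<longleftrightarrow>
    \<sigma> (k + 1) < \<sigma> k - \<theta> * (1 + \<epsilon>) * \<sigma> (k + 1) \<and>
    (if \<theta> = 0 then \<sigma> k - \<theta> * (1 + \<epsilon>) * \<sigma> (k + 1) = \<sigma> k
     else \<sigma> k - \<theta> * (1 + \<epsilon>) * \<sigma> (k + 1) < \<sigma> k)"

end

theory Submission
  imports Defs
begin

text \<open>
  In the singular bases both \<open>C\<^sub>k\<close> and \<open>A - C\<^sub>k\<close> are diagonal, so their ranks, norms and singular values
  can be read off, and everything reduces to comparing \<open>r = \<sigma>\<^sub>k / \<sigma>\<^sub>k\<^sub>+\<^sub>1 = (1 + 1/k)\<^sup>\<alpha>\<close> with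
  \<open>1 + \<theta>(1 + \<epsilon>)\<close>. For \<open>\<alpha> \<le> 1\<close> and \<open>k > 1\<close> one has \<open>r < 2\<close>. Since \<open>\<epsilon> < (r - 1)/2\<close>, the bound
  \<open>r \<ge> 3\<close> forces \<open>2 + \<epsilon> < r\<close>, and \<open>r \<ge> 3\<close> holds for all \<open>k < n\<close> once \<open>(1 + 1/n)\<^sup>\<alpha> \<ge> 3\<close>.
\<close>

section \<open>Algebra of matrices that are diagonal in given vector systems\<close>

lemma U_D_VT_mult_vec:
  "U_D_VT k u d v *v x = (\<Sum>i=1..k. (d i * (v i \<bullet> x)) *\<^sub>R u i)"
  unfolding vec_eq_iff U_D_VT_def matrix_vector_mult_def inner_vec_def
  by (simp add: sum_distrib_left sum_distrib_right sum.swap[of _ UNIV] mult_ac)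

lemma transpose_U_D_VT: "transpose (U_D_VT k u d v) = U_D_VT k v d u"
  by (simp add: U_D_VT_def transpose_def mult_ac)

text \<open>Both terms of \<open>A_trunc\<close> use the same \<open>u\<close> and \<open>v\<close>,
  so their diagonals subtract; the general results on \<open>U_D_VT\<close> thereby apply to
  it.\<close>

lemma A_trunc_eq_U_D_VT:
  "A_trunc k \<epsilon> u \<sigma> v \<theta> j =
     U_D_VT k u (\<lambda>i. \<sigma> i - \<sigma> (k + 1) * (if i = j then 1 + \<epsilon> else \<theta> * (1 + \<epsilon>))) v"
  by (simp add: A_trunc_def U_D_VT_def vec_eq_iff sum_distrib_left sum_subtractf[symmetric]
      algebra_simps)

section \<open>Coefficients and norms in orthonormal systems\<close>

lemma orthonormal_columns_inner_sum:
  assumes "orthonormal_columns k w" "i \<in> {1..k}"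
  shows "w i \<bullet> (\<Sum>l=1..k. f l *\<^sub>R w l) = f i"
proof -
  have "w i \<bullet> (\<Sum>l=1..k. f l *\<^sub>R w l) = (\<Sum>l=1..k. if l = i then f l else 0)"
    unfolding inner_sum_right using assms
    by (intro sum.cong) (auto simp: orthonormal_columns_def)
  then show ?thesis using assms by simp
qed

lemma orthonormal_columns_mono:
  "orthonormal_columns n w \<Longrightarrow> k \<le> n \<Longrightarrow> orthonormal_columns k w"
  by (auto simp: orthonormal_columns_def)

lemma orthonormal_columns_norm:
  "orthonormal_columns k w \<Longrightarrow> i \<in> {1..k} \<Longrightarrow> norm (w i) = 1"
  by (simp add: orthonormal_columns_def norm_eq_1)

lemma orthonormal_columns_norm_sum:
  assumes "orthonormal_columns k w"
  shows "(norm (\<Sum>l=1..k. f l *\<^sub>R w l))\<^sup>2 = (\<Sum>l=1..k. (f l)\<^sup>2)"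
  unfolding power2_norm_eq_inner inner_sum_left
  by (rule sum.cong) (use orthonormal_columns_inner_sum[OF assms] in \<open>auto simp: power2_eq_square\<close>)

lemma orthonormal_columns_Bessel:
  assumes "orthonormal_columns k w"
  shows "(\<Sum>l=1..k. (w l \<bullet> x)\<^sup>2) \<le> (norm x)\<^sup>2"
proof -
  \<comment> \<open>\<open>p\<close> is the orthogonal projection of \<open>x\<close> onto the span
    of the system; expanding the squared norm of \<open>x - p\<close> gives the inequality.\<close>
  define p where "p = (\<Sum>l=1..k. (w l \<bullet> x) *\<^sub>R w l)"
  have 1: "p \<bullet> x = (\<Sum>l=1..k. (w l \<bullet> x)\<^sup>2)"
    by (simp add: p_def inner_sum_left power2_eq_square)
  have 2: "p \<bullet> p = (\<Sum>l=1..k. (w l \<bullet> x)\<^sup>2)"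
    using orthonormal_columns_norm_sum[OF assms, of "\<lambda>l. w l \<bullet> x"]
    by (simp add: p_def power2_norm_eq_inner)
  have "0 \<le> (x - p) \<bullet> (x - p)" by simp
  then show ?thesis
    using 1 2 by (simp add: inner_diff_left inner_diff_right inner_commute power2_norm_eq_inner)
qed

section \<open>Norm, rank and singular values of a diagonal form\<close>

lemma spectral_norm_U_D_VT:
  assumes u: "orthonormal_columns k u" and v: "orthonormal_columns k v"
    and d: "\<And>i. i \<in> {1..k} \<Longrightarrow> \<bar>d i\<bar> \<le> d j" and j: "j \<in> {1..k}"
  shows "spectral_norm (U_D_VT k u d v) = d j"
proof -
  let ?M = "U_D_VT k u d v"
  have dj: "0 \<le> d j" using d[OF j] by linarith
  \<comment> \<open>Bessel's inequality is what fits here, since the \<open>v i\<close> need not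
    span the whole space.\<close>
  have "norm (?M *v x) \<le> d j * norm x" for x
  proof (rule power2_le_imp_le)
    have "(norm (?M *v x))\<^sup>2 = (\<Sum>i=1..k. (d i)\<^sup>2 * (v i \<bullet> x)\<^sup>2)"
      unfolding U_D_VT_mult_vec orthonormal_columns_norm_sum[OF u] power_mult_distrib ..
    also have "\<dots> \<le> (\<Sum>i=1..k. (d j)\<^sup>2 * (v i \<bullet> x)\<^sup>2)"
      using d dj by (intro sum_mono mult_right_mono) (auto simp: abs_le_square_iff[symmetric])
    also have "\<dots> \<le> (d j)\<^sup>2 * (norm x)\<^sup>2"
      unfolding sum_distrib_left[symmetric]
      by (intro mult_left_mono orthonormal_columns_Bessel[OF v]) simp
    finally show "(norm (?M *v x))\<^sup>2 \<le> (d j * norm x)\<^sup>2" by (simp add: power_mult_distrib)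
  qed (use dj in simp)
  then have le: "spectral_norm ?M \<le> d j"
    unfolding spectral_norm_def by (intro onorm_bound dj)
  \<comment> \<open>The bound is attained at the unit vector \<open>v j\<close>.\<close>
  have "?M *v v j = (\<Sum>i=1..k. if i = j then d j *\<^sub>R u j else 0)"
    unfolding U_D_VT_mult_vec using v j by (intro sum.cong) (auto simp: orthonormal_columns_def)
  then have "norm (?M *v v j) = d j"
    using j dj orthonormal_columns_norm[OF u j] by simp
  then have "d j \<le> spectral_norm ?M"
    using onorm[OF matrix_vector_mul_bounded_linear, of ?M "v j"] orthonormal_columns_norm[OF v j]
    by (simp add: spectral_norm_def)
  with le show ?thesis by simp
qed

lemma rank_U_D_VT:
  assumes u: "orthonormal_columns k u" and v: "orthonormal_columns k v"
    and d: "\<And>i. i \<in> {1..k} \<Longrightarrow> d i \<noteq> 0"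
  shows "rank (U_D_VT k u d v) = k"
proof -
  let ?M = "U_D_VT k u d v"
  have "range ((*v) ?M) = span (u ` {1..k})"
  proof
    show "range ((*v) ?M) \<subseteq> span (u ` {1..k})"
      unfolding U_D_VT_mult_vec
      by (intro image_subsetI span_sum span_scale span_base imageI)
    \<comment> \<open>Nonzero diagonal entries allow scaling \<open>v i\<close> to a preimage of
      \<open>u i\<close>, so the range is the full span.\<close>
    have "u i \<in> range ((*v) ?M)" if i: "i \<in> {1..k}" for i
    proof (rule range_eqI)
      have "?M *v ((1 / d i) *\<^sub>R v i) = (\<Sum>l=1..k. if l = i then u i else 0)"
        unfolding U_D_VT_mult_vec using v i d[OF i]
        by (intro sum.cong) (auto simp: orthonormal_columns_def)
      then show "u i = ?M *v ((1 / d i) *\<^sub>R v i)" using i by simp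
    qed
    then show "span (u ` {1..k}) \<subseteq> range ((*v) ?M)"
      by (intro span_minimal linear_subspace_image) auto
  qed
  moreover have "inj_on u {1..k}"
    using u by (intro inj_onI) (metis orthonormal_columns_def zero_neq_one)
  moreover have "independent (u ` {1..k})"
  proof (rule pairwise_orthogonal_independent)
    show "pairwise orthogonal (u ` {1..k})"
      using u by (auto simp: pairwise_def orthogonal_def orthonormal_columns_def)
    show "0 \<notin> u ` {1..k}" using orthonormal_columns_norm[OF u] by force
  qed
  ultimately show ?thesis
    by (simp add: rank_dim_range dim_eq_card_independent card_image)
qed

text \<open>Orthonormality of \<open>u\<close> cancels the left factors and leaves the spectral
  decomposition of the Gram matrix in the \<open>v i\<close>.\<close>

lemma gram_U_D_VT_mult_vec:
  assumes u: "orthonormal_columns k u"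
  shows "(transpose (U_D_VT k u d v) ** U_D_VT k u d v) *v x =
     (\<Sum>i=1..k. ((d i)\<^sup>2 * (v i \<bullet> x)) *\<^sub>R v i)"
  unfolding matrix_vector_mul_assoc[symmetric] transpose_U_D_VT
  by (subst U_D_VT_mult_vec, rule sum.cong)
    (use orthonormal_columns_inner_sum[OF u]
      in \<open>auto simp: U_D_VT_mult_vec power2_eq_square\<close>)

text \<open>An eigenvector of the Gram matrix for \<open>t\<^sup>2 \<noteq> 0\<close> cannot be
  orthogonal to all \<open>v i\<close>, as it would then be mapped to zero. Comparing a nonzero
  coefficient forces \<open>t = d i\<close> for some \<open>i\<close>, hence
  \<open>d l \<le> t\<close>.\<close>

lemma smallest_nonzero_singular_value_U_D_VT:
  assumes u: "orthonormal_columns k u" and v: "orthonormal_columns k v"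
    and d: "\<And>i. i \<in> {1..k} \<Longrightarrow> d l \<le> d i" and l: "l \<in> {1..k}" and pos: "0 < d l"
  shows "smallest_nonzero_singular_value (U_D_VT k u d v) (d l)"
  unfolding smallest_nonzero_singular_value_def
proof (intro conjI allI impI)
  let ?M = "U_D_VT k u d v"
  have "(transpose ?M ** ?M) *v v l = (\<Sum>i=1..k. if i = l then (d l)\<^sup>2 *\<^sub>R v l else 0)"
    unfolding gram_U_D_VT_mult_vec[OF u] using v l
    by (intro sum.cong) (auto simp: orthonormal_columns_def)
  moreover have "v l \<noteq> 0" using orthonormal_columns_norm[OF v l] by auto
  ultimately show "singular_value ?M (d l)"
    using l pos unfolding singular_value_def by (intro conjI exI[of _ "v l"]) auto
  show "d l \<noteq> 0" using pos by simp
  fix t assume t: "singular_value ?M t \<and> t \<noteq> 0"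
  then obtain x where x: "x \<noteq> 0" "(transpose ?M ** ?M) *v x = t\<^sup>2 *\<^sub>R x" and "0 < t"
    by (auto simp: singular_value_def)
  have eq: "(d i)\<^sup>2 * (v i \<bullet> x) = t\<^sup>2 * (v i \<bullet> x)" if "i \<in> {1..k}" for i
    using orthonormal_columns_inner_sum[OF v that, of "\<lambda>i. (d i)\<^sup>2 * (v i \<bullet> x)"]
    unfolding x(2)[unfolded gram_U_D_VT_mult_vec[OF u]] inner_scaleR_right by (rule sym)
  have "\<exists>i\<in>{1..k}. v i \<bullet> x \<noteq> 0"
  proof (rule ccontr)
    assume "\<not> ?thesis"
    then have "(transpose ?M ** ?M) *v x = 0" by (simp add: gram_U_D_VT_mult_vec[OF u])
    then show False using x t by simp
  qed
  then obtain i where i: "i \<in> {1..k}" "v i \<bullet> x \<noteq> 0" by blast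
  then have "(d i)\<^sup>2 = t\<^sup>2" using eq[OF i(1)] by simp
  then show "d l \<le> t" using d[OF i(1)] pos \<open>0 < t\<close> by (simp add: power2_eq_iff)
qed

section \<open>Inequalities available in the power law setting\<close>

context
  fixes \<zeta> \<alpha> \<epsilon> :: real and k :: nat and A :: "real^'n^'m" and u \<sigma> v
  assumes setting: "power_law_setting \<zeta> \<alpha> k \<epsilon> A u \<sigma> v"
begin

lemma power_law_setting_index: "1 < k" "k + 1 \<le> CARD('n)"
  using setting by (auto simp: power_law_setting_def)

lemma power_law_setting_eps: "0 \<le> \<epsilon>" "(1 + 2 * \<epsilon>) * \<sigma> (k + 1) < \<sigma> k"
  using setting power_law_setting_index
  by (auto simp: power_law_setting_def compact_svd_def pos_less_divide_eq)

lemma power_law_setting_pos: "i \<in> {1..CARD('n)} \<Longrightarrow> 0 < \<sigma> i"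
  using setting by (auto simp: power_law_setting_def compact_svd_def)

lemma power_law_setting_less: "1 \<le> i \<Longrightarrow> i < l \<Longrightarrow> l \<le> CARD('n) \<Longrightarrow> \<sigma> l < \<sigma> i"
  using setting by (auto simp: power_law_setting_def compact_svd_def)

lemma power_law_setting_le: "1 \<le> i \<Longrightarrow> i \<le> l \<Longrightarrow> l \<le> CARD('n) \<Longrightarrow> \<sigma> l \<le> \<sigma> i"
  using power_law_setting_less[of i l] by (cases "i = l") auto

lemma power_law_setting_orthonormal:
  "orthonormal_columns CARD('n) u" "orthonormal_columns CARD('n) v"
  "orthonormal_columns k u" "orthonormal_columns k v"
  using setting power_law_setting_index orthonormal_columns_mono[of "CARD('n)" _ k]
  by (auto simp: power_law_setting_def compact_svd_def)

lemma power_law_setting_ratio: "\<sigma> k = (1 + 1 / real k) powr \<alpha> * \<sigma> (k + 1)"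
proof -
  have "(1 + 1 / real k) powr \<alpha> = real (k + 1) powr \<alpha> / real k powr \<alpha>"
    using power_law_setting_index by (simp add: powr_divide[symmetric] field_simps)
  moreover have "\<sigma> k = \<zeta> * real k powr - \<alpha>" "\<sigma> (k + 1) = \<zeta> * real (k + 1) powr - \<alpha>"
    using setting power_law_setting_index by (auto simp: power_law_setting_def power_law_def)
  ultimately show ?thesis by (simp add: powr_minus field_simps)
qed

lemma power_law_setting_shift:
  assumes "\<theta> \<in> {0..1}"
  shows "0 \<le> \<theta> * (1 + \<epsilon>) * \<sigma> (k + 1)" "\<theta> * (1 + \<epsilon>) * \<sigma> (k + 1) \<le> (1 + \<epsilon>) * \<sigma> (k + 1)"
    "(1 + \<epsilon>) * \<sigma> (k + 1) < (\<sigma> k + \<sigma> (k + 1)) / 2" "(1 + \<epsilon>) * \<sigma> (k + 1) < \<sigma> k"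
proof -
  have pos: "0 < \<sigma> (k + 1)" using power_law_setting_pos power_law_setting_index by simp
  define s where "s = (1 + \<epsilon>) * \<sigma> (k + 1)"
  have "\<sigma> (k + 1) \<le> s" using pos power_law_setting_eps by (simp add: s_def)
  \<comment> \<open>This is the hypothesis on \<epsilon> rewritten in \<open>s\<close>. Solving for
    \<open>s\<close> gives the midpoint bound; inserting \<open>\<sigma> (k + 1) \<le> s\<close>
    gives \<open>s < \<sigma> k\<close>.\<close>
  moreover have "2 * s - \<sigma> (k + 1) < \<sigma> k"
    using power_law_setting_eps by (simp add: s_def algebra_simps)
  ultimately show "(1 + \<epsilon>) * \<sigma> (k + 1) < (\<sigma> k + \<sigma> (k + 1)) / 2" "(1 + \<epsilon>) * \<sigma> (k + 1) < \<sigma> k"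
    unfolding s_def[symmetric] by simp_all
  show "0 \<le> \<theta> * (1 + \<epsilon>) * \<sigma> (k + 1)" using assms pos power_law_setting_eps by simp
  show "\<theta> * (1 + \<epsilon>) * \<sigma> (k + 1) \<le> (1 + \<epsilon>) * \<sigma> (k + 1)"
    using assms pos power_law_setting_eps by (intro mult_right_mono mult_left_le_one_le) auto
qed

section \<open>Approximation quality and smallest singular value of the truncated matrix\<close>

lemma near_best_rank_approx_A_trunc:
  assumes \<theta>: "\<theta> \<in> {0..1}" and j: "j \<in> {1..k - 1}"
  shows "near_best_rank_approx A \<sigma> k \<epsilon> (A_trunc k \<epsilon> u \<sigma> v \<theta> j)"
  unfolding near_best_rank_approx_def rank_approx_def
proof (intro conjI)
  let ?C = "A_trunc k \<epsilon> u \<sigma> v \<theta> j" and ?s = "\<sigma> (k + 1)"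
  note idx = power_law_setting_index and shift = power_law_setting_shift[OF \<theta>]
  have pos: "0 < ?s" using power_law_setting_pos idx by simp
  show "0 \<le> \<epsilon>" by (fact power_law_setting_eps)
  show "(1 + \<epsilon>) * ?s < (\<sigma> k + ?s) / 2" by (fact shift)
  show "rank ?C = k"
    unfolding A_trunc_eq_U_D_VT
  proof (rule rank_U_D_VT[OF power_law_setting_orthonormal(3,4)])
    \<comment> \<open>At most \<open>(1 + \<epsilon>) * \<sigma> (k + 1)\<close> is subtracted from
      \<open>\<sigma> i\<close>, which is less than \<open>\<sigma> k \<le> \<sigma> i\<close>, so
      no diagonal entry vanishes.\<close>
    fix i assume "i \<in> {1..k}"
    then have "\<sigma> k \<le> \<sigma> i" using power_law_setting_le idx by simp
    then show "\<sigma> i - ?s * (if i = j then 1 + \<epsilon> else \<theta> * (1 + \<epsilon>)) \<noteq> 0"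
      using shift by (auto simp: algebra_simps)
  qed
  \<comment> \<open>\<open>e\<close> is the diagonal of \<open>A - ?C\<close>: the subtracted
    amounts up to index \<open>k\<close>, the untouched singular values after it. Its largest entry
    is \<open>e j\<close>.\<close>
  define e where "e i = (if i \<le> k then ?s * (if i = j then 1 + \<epsilon> else \<theta> * (1 + \<epsilon>)) else \<sigma> i)" for i
  have split: "{1..CARD('n)} = {1..k} \<union> {k + 1..CARD('n)}" using idx by auto
  have "A - ?C = U_D_VT CARD('n) u e v"
  proof -
    have "A = U_D_VT CARD('n) u \<sigma> v"
      using setting by (simp add: power_law_setting_def compact_svd_def)
    then show ?thesis
      unfolding A_trunc_eq_U_D_VT U_D_VT_def vec_eq_iff split
      by (simp add: sum.union_disjoint sum_subtractf[symmetric] e_def left_diff_distrib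
          right_diff_distrib)
  qed
  moreover have "\<bar>e i\<bar> \<le> e j" if "i \<in> {1..CARD('n)}" for i
  proof (cases "i \<le> k")
    case True
    then show ?thesis using j shift by (auto simp: e_def mult_ac)
  next
    case False
    then have "0 < \<sigma> i" "\<sigma> i \<le> ?s"
      using that power_law_setting_pos power_law_setting_le[of "k + 1" i] by auto
    moreover have "0 \<le> \<epsilon> * ?s" using pos power_law_setting_eps by simp
    ultimately show ?thesis using False j by (auto simp: e_def algebra_simps)
  qed
  moreover have "j \<in> {1..CARD('n)}" using j idx by auto
  ultimately have "spectral_norm (A - ?C) = e j"
    using spectral_norm_U_D_VT[OF power_law_setting_orthonormal(1,2), of e j]
    by (simp del: One_nat_def)
  then show "spectral_norm (A - ?C) = (1 + \<epsilon>) * ?s" using j by (auto simp: e_def)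
qed

text \<open>Entry \<open>j\<close> is lowered by
  \<open>(1 - \<theta>) * ((1 + \<epsilon>) * \<sigma> (k + 1))\<close> more than entry
  \<open>k\<close> and could fall below it. As \<open>j \<le> k - 1\<close> gives
  \<open>\<sigma> (k - 1) \<le> \<sigma> j\<close>, the assumption \<open>gap\<close> excludes
  this.\<close>

lemma smallest_nonzero_singular_value_A_trunc:
  assumes \<theta>: "\<theta> \<in> {0..1}" and j: "j \<in> {1..k - 1}"
    and gap: "(1 - \<theta>) * ((1 + \<epsilon>) * \<sigma> (k + 1)) \<le> \<sigma> (k - 1) - \<sigma> k"
  shows "smallest_nonzero_singular_value (A_trunc k \<epsilon> u \<sigma> v \<theta> j)
    (\<sigma> k - \<theta> * (1 + \<epsilon>) * \<sigma> (k + 1))"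
proof -
  let ?d = "\<lambda>i. \<sigma> i - \<sigma> (k + 1) * (if i = j then 1 + \<epsilon> else \<theta> * (1 + \<epsilon>))"
  note shift = power_law_setting_shift[OF \<theta>] and idx = power_law_setting_index
  have dk: "?d k = \<sigma> k - \<theta> * (1 + \<epsilon>) * \<sigma> (k + 1)" using j by (auto simp: mult_ac)
  have "?d k \<le> ?d i" if "i \<in> {1..k}" for i
  proof (cases "i = j")
    case True
    then have "\<sigma> (k - 1) \<le> \<sigma> i" using j idx by (intro power_law_setting_le) auto
    then show ?thesis unfolding dk using True gap by (simp add: algebra_simps)
  next
    case False
    then show ?thesis unfolding dk
      using that idx power_law_setting_le[of i k] by (simp add: mult_ac)
  qed
  moreover have "0 < ?d k" unfolding dk using shift by linarith
  ultimately show ?thesis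
    using smallest_nonzero_singular_value_U_D_VT[OF power_law_setting_orthonormal(3,4), of ?d k] idx
    unfolding A_trunc_eq_U_D_VT dk by simp
qed

section \<open>Position of the shifted value relative to its neighbours\<close>

lemma lies_between_iff:
  assumes \<theta>: "\<theta> \<in> {0..1}"
  shows "lies_between \<sigma> k \<epsilon> \<theta> \<longleftrightarrow> \<theta> * ((1 + \<epsilon>) * \<sigma> (k + 1)) < \<sigma> k - \<sigma> (k + 1)"
proof -
  \<comment> \<open>Positivity settles the upper inequality for nonzero \<theta>, and \<theta> = 0
    gives the equality, so only the lower inequality is a condition.\<close>
  have "0 < \<theta> * (1 + \<epsilon>) * \<sigma> (k + 1)" if "\<theta> \<noteq> 0"
    using that \<theta> power_law_setting_pos[of "k + 1"] power_law_setting_index power_law_setting_eps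
    by simp
  then show ?thesis by (auto simp: lies_between_def algebra_simps)
qed

lemma sigma_shift_less_if_theta_near_one:
  assumes "\<alpha> \<le> 1"
  shows "\<exists>\<delta>>0. \<forall>\<theta>\<in>{0..1}. 1 - \<delta> < \<theta> \<longrightarrow> (\<forall>j\<in>{1..k - 1}.
    smallest_nonzero_singular_value (A_trunc k \<epsilon> u \<sigma> v \<theta> j)
      (\<sigma> k - \<theta> * (1 + \<epsilon>) * \<sigma> (k + 1)) \<and>
    \<sigma> k - \<theta> * (1 + \<epsilon>) * \<sigma> (k + 1) < \<sigma> (k + 1))"
proof -
  let ?t = "(1 + \<epsilon>) * \<sigma> (k + 1)"
  note idx = power_law_setting_index
  have pos: "0 < \<sigma> (k + 1)" using power_law_setting_pos idx by simp
  have t: "\<sigma> (k + 1) \<le> ?t" "0 < ?t" using pos power_law_setting_eps by simp_all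
  have "(1 + 1 / real k) powr \<alpha> \<le> (1 + 1 / real k) powr 1" using assms by (intro powr_mono) auto
  also have "\<dots> < 2" using idx by (simp add: field_simps)
  finally have "\<sigma> k < 2 * \<sigma> (k + 1)" unfolding power_law_setting_ratio using pos by simp
  then have gap1: "0 < \<sigma> (k + 1) + ?t - \<sigma> k" using t by linarith
  have gap2: "0 < \<sigma> (k - 1) - \<sigma> k" using power_law_setting_less[of "k - 1" k] idx by simp
  \<comment> \<open>Both claims are upper bounds on \<open>(1 - \<theta>) * ?t\<close>: the first
    argument of \<open>min\<close> places the shifted value below \<open>\<sigma> (k + 1)\<close>,
    the second ensures \<open>gap\<close>. Neither depends on \<open>j\<close>.\<close>
  define \<delta> where "\<delta> = min (\<sigma> (k + 1) + ?t - \<sigma> k) (\<sigma> (k - 1) - \<sigma> k) / ?t"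
  show ?thesis
  proof (intro exI[of _ \<delta>] conjI ballI impI)
    show "0 < \<delta>" using gap1 gap2 t by (simp add: \<delta>_def)
    fix \<theta> j assume \<theta>: "\<theta> \<in> {0..1}" "1 - \<delta> < \<theta>" and j: "j \<in> {1..k - 1}"
    have "(1 - \<theta>) * ?t < \<delta> * ?t" using \<theta> t by (intro mult_strict_right_mono) auto
    also have "\<delta> * ?t = min (\<sigma> (k + 1) + ?t - \<sigma> k) (\<sigma> (k - 1) - \<sigma> k)"
      unfolding \<delta>_def using t(2) by (metis less_irrefl nonzero_divide_eq_eq)
    finally have *: "(1 - \<theta>) * ?t < min (\<sigma> (k + 1) + ?t - \<sigma> k) (\<sigma> (k - 1) - \<sigma> k)" .
    then show "smallest_nonzero_singular_value (A_trunc k \<epsilon> u \<sigma> v \<theta> j)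
      (\<sigma> k - \<theta> * (1 + \<epsilon>) * \<sigma> (k + 1))"
      using \<theta> j by (intro smallest_nonzero_singular_value_A_trunc) auto
    show "\<sigma> k - \<theta> * (1 + \<epsilon>) * \<sigma> (k + 1) < \<sigma> (k + 1)" using * by (simp add: algebra_simps)
  qed
qed

lemma lies_between_if_theta_near_zero: "\<exists>\<delta>>0. \<forall>\<theta>\<in>{0..1}. \<theta> < \<delta> \<longrightarrow> lies_between \<sigma> k \<epsilon> \<theta>"
proof -
  let ?t = "(1 + \<epsilon>) * \<sigma> (k + 1)"
  have t: "0 < ?t"
    using power_law_setting_pos[of "k + 1"] power_law_setting_index power_law_setting_eps by simp
  show ?thesis
  \<comment> \<open>The witness is the exact threshold for \<theta> in
    \<open>lies_between_iff\<close>.\<close>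
  proof (intro exI[of _ "(\<sigma> k - \<sigma> (k + 1)) / ?t"] conjI ballI impI)
    show "0 < (\<sigma> k - \<sigma> (k + 1)) / ?t"
      using t power_law_setting_less[of k "k + 1"] power_law_setting_index by simp
    fix \<theta> :: real assume "\<theta> \<in> {0..1}" "\<theta> < (\<sigma> k - \<sigma> (k + 1)) / ?t"
    then show "lies_between \<sigma> k \<epsilon> \<theta>"
      using t by (simp only: lies_between_iff pos_less_divide_eq)
  qed
qed

text \<open>The shift is below \<open>(\<sigma> k + \<sigma> (k + 1)) / 2\<close>, and this midpoint
  is at most \<open>\<sigma> k - \<sigma> (k + 1)\<close> exactly when
  \<open>3 * \<sigma> (k + 1) \<le> \<sigma> k\<close>; hence the constant 3.\<close>

lemma lies_between_ratio_ge_3: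
  assumes "\<theta> \<in> {0..1}" "3 * \<sigma> (k + 1) \<le> \<sigma> k"
  shows "lies_between \<sigma> k \<epsilon> \<theta>"
  using assms power_law_setting_shift[OF assms(1)] by (simp add: lies_between_iff mult.assoc)

end

theorem theorem7p1:
  shows
    "(\<forall>\<zeta> \<alpha> k \<epsilon> (A :: real^'n^'m) u \<sigma> v. power_law_setting \<zeta> \<alpha> k \<epsilon> A u \<sigma> v \<longrightarrow>
        (\<forall>\<theta>\<in>{0..1}. \<forall>j\<in>{1..k - 1}.
           best_rank_approx A \<sigma> k (A_trunc k \<epsilon> u \<sigma> v \<theta> j) \<or>
           near_best_rank_approx A \<sigma> k \<epsilon> (A_trunc k \<epsilon> u \<sigma> v \<theta> j)))
   \<and> (\<forall>\<zeta> \<alpha> k \<epsilon> (A :: real^'n^'m) u \<sigma> v. power_law_setting \<zeta> \<alpha> k \<epsilon> A u \<sigma> v \<and> \<alpha> \<le> 1 \<longrightarrow>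
        (\<exists>\<delta>>0. \<forall>\<theta>\<in>{0..1}. 1 - \<delta> < \<theta> \<longrightarrow> (\<forall>j\<in>{1..k - 1}.
           smallest_nonzero_singular_value (A_trunc k \<epsilon> u \<sigma> v \<theta> j)
             (\<sigma> k - \<theta> * (1 + \<epsilon>) * \<sigma> (k + 1)) \<and>
           \<sigma> k - \<theta> * (1 + \<epsilon>) * \<sigma> (k + 1) < \<sigma> (k + 1))) \<and>
        (\<exists>\<delta>>0. \<forall>\<theta>\<in>{0..1}. \<theta> < \<delta> \<longrightarrow> lies_between \<sigma> k \<epsilon> \<theta>))
   \<and> (\<exists>\<alpha>\<^sub>0>1. \<forall>\<alpha>\<ge>\<alpha>\<^sub>0. \<forall>\<zeta> k \<epsilon> (A :: real^'n^'m) u \<sigma> v. power_law_setting \<zeta> \<alpha> k \<epsilon> A u \<sigma> v \<longrightarrow>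
        (\<forall>\<theta>\<in>{0..1}. lies_between \<sigma> k \<epsilon> \<theta>))"
proof (intro conjI)
  \<comment> \<open>\<open>b\<close> bounds \<open>1 + 1 / real k\<close> from below for every
    admissible \<open>k\<close>, which makes the threshold depend on the number of columns
    only.\<close>
  define b where "b = 1 + 1 / real CARD('n)"
  have b: "1 < b" by (simp add: b_def)
  \<comment> \<open>The logarithm yields \<open>3 \<le> b powr \<alpha>\<close>; the 2 guarantees a
    threshold above 1.\<close>
  define \<alpha>\<^sub>0 where "\<alpha>\<^sub>0 = max 2 (log b 3)"
  show "\<exists>\<alpha>\<^sub>0>1. \<forall>\<alpha>\<ge>\<alpha>\<^sub>0. \<forall>\<zeta> k \<epsilon> (A :: real^'n^'m) u \<sigma> v. power_law_setting \<zeta> \<alpha> k \<epsilon> A u \<sigma> v \<longrightarrow>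
      (\<forall>\<theta>\<in>{0..1}. lies_between \<sigma> k \<epsilon> \<theta>)"
  proof (intro exI[of _ \<alpha>\<^sub>0] conjI allI impI ballI)
    show "1 < \<alpha>\<^sub>0" by (simp add: \<alpha>\<^sub>0_def)
    fix \<alpha> \<zeta> k \<epsilon> \<sigma> u v \<theta> and A :: "real^'n^'m"
    assume \<alpha>: "\<alpha>\<^sub>0 \<le> \<alpha>" and S: "power_law_setting \<zeta> \<alpha> k \<epsilon> A u \<sigma> v" and \<theta>: "\<theta> \<in> {0..1::real}"
    note idx = power_law_setting_index[OF S]
    have "3 = b powr log b 3" using b by simp
    also have "\<dots> \<le> b powr \<alpha>" using b \<alpha> by (intro powr_mono) (auto simp: \<alpha>\<^sub>0_def)
    also have "\<dots> \<le> (1 + 1 / real k) powr \<alpha>"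
      using b idx \<alpha> by (intro powr_mono2) (auto simp: \<alpha>\<^sub>0_def b_def frac_le)
    finally have "3 * \<sigma> (k + 1) \<le> \<sigma> k"
      unfolding power_law_setting_ratio[OF S]
      using power_law_setting_pos[OF S, of "k + 1"] idx by (intro mult_right_mono) auto
    then show "lies_between \<sigma> k \<epsilon> \<theta>" by (rule lies_between_ratio_ge_3[OF S \<theta>])
  qed
qed (blast intro: near_best_rank_approx_A_trunc sigma_shift_less_if_theta_near_one lies_between_if_theta_near_zero)+

end
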